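(* For every prime number $p>2$, each of the following polynomials is irreducible over $\mathbb{Q}$: $D_p(x)/D_1(x)$ (Lucas), $Q_p(x)/Q_1(x)$ (Pell-Lucas), $\vartheta_p(x)/\vartheta_1(x)$ (Fermat-Lucas), $T_p(x)/T_1(x)$ (Chebyshev first kind), $C_p(x)/C_1(x)$ (Morgan-Voyce, Lucas type), and $v_p(x)/v_1(x)$ (Vieta-Lucas).
   Context: The polynomial sequences are defined for $n\ge 2$ by: Lucas: $D_0=2$, $D_1=x$, $D_n(x)=xD_{n-1}(x)+D_{n-2}(x)$; Pell-Lucas: $Q_0=2$, $Q_1=2x$, $Q_n(x)=2xQ_{n-1}(x)+Q_{n-2}(x)$; Fermat-Lucas: $\vartheta_0=2$, $\vartheta_1=3x$, $\vartheta_n(x)=3x\vartheta_{n-1}(x)-2\vartheta_{n-2}(x)$; Chebyshev first kind: $T_0=1$, $T_1=x$, $T_n(x)=2xT_{n-1}(x)-T_{n-2}(x)$; Morgan-Voyce (Lucas type): $C_0=2$, $C_1=x+2$, $C_n(x)=(x+2)C_{n-1}(x)-C_{n-2}(x)$; Vieta-Lucas: $v_0=2$, $v_1=x$, $v_n(x)=xv_{n-1}(x)-v_{n-2}(x)$. *)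

theory Defs
  imports "HOL-Computational_Algebra.Polynomial_Factorial"
begin

text \<open>All sequences are taken directly in \<open>\<rat>[x]\<close>, since the claim is about irreducibility
  over \<open>\<rat>\<close>; the literal \<open>[:a, b:]\<close> is the polynomial \<open>a + b x\<close>.\<close>

fun lucas_poly :: "nat \<Rightarrow> rat poly" where
  "lucas_poly 0 = [:2:]"
| "lucas_poly (Suc 0) = [:0, 1:]"
| "lucas_poly (Suc (Suc n)) = [:0, 1:] * lucas_poly (Suc n) + lucas_poly n"

fun pell_lucas_poly :: "nat \<Rightarrow> rat poly" where
  "pell_lucas_poly 0 = [:2:]"
| "pell_lucas_poly (Suc 0) = [:0, 2:]"
| "pell_lucas_poly (Suc (Suc n)) = [:0, 2:] * pell_lucas_poly (Suc n) + pell_lucas_poly n"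

fun fermat_lucas_poly :: "nat \<Rightarrow> rat poly" where
  "fermat_lucas_poly 0 = [:2:]"
| "fermat_lucas_poly (Suc 0) = [:0, 3:]"
| "fermat_lucas_poly (Suc (Suc n)) =
     [:0, 3:] * fermat_lucas_poly (Suc n) - [:2:] * fermat_lucas_poly n"

fun chebyshev_T_poly :: "nat \<Rightarrow> rat poly" where
  "chebyshev_T_poly 0 = [:1:]"
| "chebyshev_T_poly (Suc 0) = [:0, 1:]"
| "chebyshev_T_poly (Suc (Suc n)) = [:0, 2:] * chebyshev_T_poly (Suc n) - chebyshev_T_poly n"

fun morgan_voyce_lucas_poly :: "nat \<Rightarrow> rat poly" where
  "morgan_voyce_lucas_poly 0 = [:2:]"
| "morgan_voyce_lucas_poly (Suc 0) = [:2, 1:]"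
| "morgan_voyce_lucas_poly (Suc (Suc n)) =
     [:2, 1:] * morgan_voyce_lucas_poly (Suc n) - morgan_voyce_lucas_poly n"

fun vieta_lucas_poly :: "nat \<Rightarrow> rat poly" where
  "vieta_lucas_poly 0 = [:2:]"
| "vieta_lucas_poly (Suc 0) = [:0, 1:]"
| "vieta_lucas_poly (Suc (Suc n)) = [:0, 1:] * vieta_lucas_poly (Suc n) - vieta_lucas_poly n"

text \<open>The quotient \<open>f / g\<close> is a polynomial, and it is irreducible over \<open>\<rat>\<close>. Since \<open>div\<close> on
  polynomials discards a remainder, exact divisibility is part of the claim.\<close>

definition irreducible_quotient :: "rat poly \<Rightarrow> rat poly \<Rightarrow> bool" where
  "irreducible_quotient f g \<longleftrightarrow> g dvd f \<and> irreducible (f div g)"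

end

(*
  All six sequences are affine substitutions (up to a constant factor) of the Dickson polynomials
  E 0 = 2, E 1 = x, E (n + 2) = x * E (n + 1) - a * E n with a in {-1, 1, 2}.  The derivative of
  E n is n * F n, where F is the companion sequence of the second kind.  Hence, for an odd prime p,
  all coefficients of E p strictly between degrees 0 and p are divisible by p, the linear
  coefficient is p * (-a)^((p-1)/2), and Eisenstein's criterion applies to E p / x.
*)
theory Submission
  imports Defs "Berlekamp_Zassenhaus.Factor_Bound"
begin

hide_const (open) up_ring.coeff module.smult Divisibility.prime Divisibility.irreducible

section \<open>Eisenstein's criterion and affine substitutions\<close>

text \<open>In a factorization into lower degrees, \<open>q\<close> divides exactly one of the two
  constant coefficients. The factor with that property has a first coefficient not divisible by
  \<open>q\<close>, and the coefficient of \<open>f\<close> at the same index then contradicts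
  \<open>low\<close>.\<close>

lemma eisenstein_criterion:
  fixes f :: "'a :: idom poly"
  assumes q: "prime_elem q"
    and lead: "\<not> q dvd lead_coeff f"
    and low: "\<And>i. i < degree f \<Longrightarrow> q dvd coeff f i"
    and const: "\<not> q\<^sup>2 dvd coeff f 0"
    and deg: "degree f > 0"
  shows "irreducible\<^sub>d f"
proof -
  have key: False
    if f: "f = g * h" and dg: "degree g < degree f" and qg: "q dvd coeff g 0"
      and qh: "\<not> q dvd coeff h 0" for g h
  proof -
    have "lead_coeff f = lead_coeff g * lead_coeff h"
      unfolding f by (rule lead_coeff_mult)
    hence "\<not> q dvd lead_coeff g"
      using lead by auto
    \<comment> \<open>Such an index exists: the leading coefficient of \<open>g\<close> divides that
      of \<open>f\<close>. Modulo \<open>q\<close>, \<open>coeff f i\<close> reduces to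
      \<open>coeff g i * coeff h 0\<close>.\<close>
    define i where "i = (LEAST i. \<not> q dvd coeff g i)"
    have i: "\<not> q dvd coeff g i"
      unfolding i_def by (rule LeastI) fact
    have "i \<le> degree g"
      unfolding i_def by (rule Least_le) fact
    hence "q dvd coeff f i"
      using dg low by simp
    moreover have "coeff f i = coeff g i * coeff h 0 + (\<Sum>j<i. coeff g j * coeff h (i - j))"
      unfolding f coeff_mult by (simp add: lessThan_Suc_atMost [symmetric] add.commute)
    moreover have "q dvd (\<Sum>j<i. coeff g j * coeff h (i - j))"
      by (intro dvd_sum dvd_mult2) (use not_less_Least i_def in blast)
    ultimately have "q dvd coeff g i * coeff h 0"
      by (simp add: dvd_add_left_iff)
    thus False
      using q i qh by (simp add: prime_elem_dvd_mult_iff)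
  qed
  show ?thesis
  proof (rule irreducible\<^sub>dI[OF deg])
    fix g h
    assume d: "degree g < degree f" "degree h < degree f" and f: "f = g * h"
    have c: "coeff f 0 = coeff g 0 * coeff h 0"
      unfolding f by (simp add: coeff_mult)
    have "q dvd coeff g 0 * coeff h 0"
      using low[OF deg] c by simp
    moreover have "\<not> (q dvd coeff g 0 \<and> q dvd coeff h 0)"
      using const c by (auto simp: power2_eq_square intro: mult_dvd_mono)
    ultimately show False
      using q key[OF f d(1)] key[of h g] d(2) f
      by (auto simp: prime_elem_dvd_mult_iff mult.commute)
  qed
qed

text \<open>An invertible affine substitution preserves degrees, so composing with its inverse
  \<open>?g'\<close> carries a proper factorization back to \<open>f\<close>.\<close>

lemma irreducible_pcompose_linear:
  fixes f :: "'a :: field poly"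
  assumes irr: "irreducible f" and d: "d \<noteq> 0"
  shows "irreducible (f \<circ>\<^sub>p [:b, d:])"
proof -
  let ?g = "[:b, d:]" and ?g' = "[:- b / d, 1 / d:]"
  have id: "?g \<circ>\<^sub>p ?g' = [:0, 1:]"
    using d by (simp add: pcompose_pCons)
  have irr_d: "irreducible\<^sub>d f"
    using irr by simp
  have "irreducible\<^sub>d (f \<circ>\<^sub>p ?g)"
  proof (rule irreducible\<^sub>dI)
    show "degree (f \<circ>\<^sub>p ?g) > 0"
      using irreducible\<^sub>dD(1)[OF irr_d] d by (simp add: degree_pcompose)
  next
    fix q r
    assume deg: "degree q < degree (f \<circ>\<^sub>p ?g)" "degree r < degree (f \<circ>\<^sub>p ?g)"
      and qr: "f \<circ>\<^sub>p ?g = q * r"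
    have "f = f \<circ>\<^sub>p ?g \<circ>\<^sub>p ?g'"
      by (simp only: pcompose_assoc [symmetric] id pcompose_idR)
    hence "f = (q \<circ>\<^sub>p ?g') * (r \<circ>\<^sub>p ?g')"
      by (simp only: qr pcompose_mult)
    moreover have "degree (q \<circ>\<^sub>p ?g') < degree f" "degree (r \<circ>\<^sub>p ?g') < degree f"
      using deg d by (simp_all add: degree_pcompose)
    ultimately show False
      using irreducible\<^sub>dD(2)[OF irr_d] by blast
  qed
  thus ?thesis
    by simp
qed

section \<open>Dickson polynomials of both kinds\<close>

fun dickson_poly :: "'a :: idom \<Rightarrow> nat \<Rightarrow> 'a poly" where
  "dickson_poly a 0 = [:2:]"
| "dickson_poly a (Suc 0) = [:0, 1:]"
| "dickson_poly a (Suc (Suc n)) = [:0, 1:] * dickson_poly a (Suc n) - [:a:] * dickson_poly a n"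

text \<open>Shifted by one against the usual Dickson polynomials of the second kind: the degree of
  \<open>dickson_poly2 a n\<close> is \<open>n - 1\<close>.\<close>

fun dickson_poly2 :: "'a :: idom \<Rightarrow> nat \<Rightarrow> 'a poly" where
  "dickson_poly2 a 0 = 0"
| "dickson_poly2 a (Suc 0) = 1"
| "dickson_poly2 a (Suc (Suc n)) = [:0, 1:] * dickson_poly2 a (Suc n) - [:a:] * dickson_poly2 a n"

text \<open>Both sides obey the same recurrence. This form uses just the two second-kind terms that
  occur when the first-kind recurrence is differentiated.\<close>

lemma dickson_poly_Suc:
  "dickson_poly a (Suc n) = [:0, 1:] * dickson_poly2 a (Suc n) - [:2 * a:] * dickson_poly2 a n"
proof (induction a n rule: dickson_poly2.induct)
  case (3 a n)
  have "dickson_poly a (Suc (Suc (Suc n)))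
      = [:0, 1:] * dickson_poly a (Suc (Suc n)) - [:a:] * dickson_poly a (Suc n)"
    by (simp only: dickson_poly.simps)
  also have "\<dots> = [:0, 1:] * ([:0, 1:] * dickson_poly2 a (Suc (Suc n)) - [:2 * a:] * dickson_poly2 a (Suc n))
      - [:a:] * ([:0, 1:] * dickson_poly2 a (Suc n) - [:2 * a:] * dickson_poly2 a n)"
    using 3 by simp
  \<comment> \<open>Regrouping by the outer factors \<open>x\<close> and \<open>2 * a\<close> turns
    each bracket into a second-kind recurrence.\<close>
  also have "\<dots> = [:0, 1:] * ([:0, 1:] * dickson_poly2 a (Suc (Suc n)) - [:a:] * dickson_poly2 a (Suc n))
      - [:2 * a:] * ([:0, 1:] * dickson_poly2 a (Suc n) - [:a:] * dickson_poly2 a n)"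
    by (simp add: algebra_simps smult_add_left[symmetric])
  finally show ?case
    by (simp only: dickson_poly2.simps)
qed simp_all

text \<open>The product rule leaves an extra \<open>dickson_poly a (Suc n)\<close>. Expanded by
  \<open>dickson_poly_Suc\<close>, it raises the multiplicities \<open>n + 1\<close> and
  \<open>n\<close> of the two recurrence terms to the common value \<open>n + 2\<close>.\<close>

lemma pderiv_dickson_poly: "pderiv (dickson_poly a n) = of_nat n * dickson_poly2 a n"
proof (induction a n rule: dickson_poly.induct)
  case (3 a n)
  have two: "[:2 * a:] = [:a:] + [:a:]"
    by simp
  have "pderiv (dickson_poly a (Suc (Suc n))) = dickson_poly a (Suc n)
      + [:0, 1:] * pderiv (dickson_poly a (Suc n)) - [:a:] * pderiv (dickson_poly a n)"
    by (simp add: pderiv_diff pderiv_mult pderiv_pCons pderiv_smult)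
  also have "\<dots> = ([:0, 1:] * dickson_poly2 a (Suc n) - ([:a:] + [:a:]) * dickson_poly2 a n)
      + [:0, 1:] * (of_nat (Suc n) * dickson_poly2 a (Suc n))
      - [:a:] * (of_nat n * dickson_poly2 a n)"
    unfolding 3 by (simp only: dickson_poly_Suc two)
  also have "\<dots> = of_nat (Suc (Suc n))
      * ([:0, 1:] * dickson_poly2 a (Suc n) - [:a:] * dickson_poly2 a n)"
    by (simp only: of_nat_Suc algebra_simps mult_1_left mult_1_right)
  finally show ?case
    by (simp only: dickson_poly2.simps)
qed (simp_all add: pderiv_pCons)

lemma coeff_0_dickson_poly_odd: "odd n \<Longrightarrow> coeff (dickson_poly a n) 0 = 0"
  by (induction a n rule: dickson_poly.induct) auto

text \<open>At \<open>x = 0\<close> the recurrence multiplies by \<open>- a\<close> every two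
  steps.\<close>

lemma coeff_0_dickson_poly2_odd: "odd n \<Longrightarrow> coeff (dickson_poly2 a n) 0 = (- a) ^ (n div 2)"
  by (induction a n rule: dickson_poly2.induct) auto

lemma dickson_poly_monic:
  "n > 0 \<Longrightarrow> degree (dickson_poly a n) = n \<and> coeff (dickson_poly a n) n = 1"
proof (induction a n rule: dickson_poly.induct)
  case (3 a n)
  let ?x = "pCons 0 (dickson_poly a (Suc n))"
  have x: "degree ?x = Suc (Suc n)" "coeff ?x (Suc (Suc n)) = 1"
    using 3 by (auto simp: degree_pCons_eq_if)
  \<comment> \<open>The induction hypothesis is silent at index 0, where the polynomial is the
    constant 2.\<close>
  have "degree (smult a (dickson_poly a n)) \<le> n"
    using 3 by (cases n) (auto intro: order_trans[OF degree_smult_le])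
  hence small: "degree (smult a (dickson_poly a n)) < Suc (Suc n)"
    by simp
  have "coeff (dickson_poly a (Suc (Suc n))) (Suc (Suc n)) = 1"
    using x coeff_eq_0[OF small] by simp
  moreover have "degree (dickson_poly a (Suc (Suc n))) \<le> Suc (Suc n)"
    using x small by (simp add: degree_diff_le)
  ultimately show ?case
    by (metis le_antisym le_degree zero_neq_one)
qed simp_all

section \<open>Irreducibility at odd prime index\<close>

text \<open>Comparing coefficients in the derivative formula shows that \<open>p\<close> divides
  \<open>i\<close> times the coefficient, and \<open>p\<close> is coprime to
  \<open>i\<close>.\<close>

lemma prime_dvd_coeff_dickson_poly:
  fixes a :: int
  assumes p: "prime p" and i: "0 < i" "i < p"
  shows "int p dvd coeff (dickson_poly a p) i"
proof -
  obtain j where j: "i = Suc j"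
    using i by (cases i) auto
  have "int i * coeff (dickson_poly a p) i = coeff (pderiv (dickson_poly a p)) j"
    by (simp add: coeff_pderiv j)
  also have "\<dots> = int p * coeff (dickson_poly2 a p) j"
    by (simp add: pderiv_dickson_poly of_nat_poly)
  finally have "int p dvd int i * coeff (dickson_poly a p) i"
    by simp
  moreover have "\<not> int p dvd int i"
    using i by (auto dest: dvd_imp_le)
  ultimately show ?thesis
    using p by (simp add: prime_dvd_mult_iff)
qed

lemma dickson_poly_prime_factor:
  fixes a :: int
  assumes p: "prime p" "odd p" and a: "\<not> int p dvd a"
  obtains G where "dickson_poly a p = [:0, 1:] * G" and "irreducible\<^sub>d G"
proof -
  obtain c G where "dickson_poly a p = pCons c G"
    by (cases "dickson_poly a p")
  hence E: "dickson_poly a p = pCons 0 G"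
    using coeff_0_dickson_poly_odd[OF p(2), of a] by simp
  have p3: "p > 2"
    using p prime_ge_2_nat[of p] by (cases "p = 2") auto
  have coeff_G: "coeff G i = coeff (dickson_poly a p) (Suc i)" for i
    by (simp add: E)
  have monic: "degree (dickson_poly a p) = p" "coeff (dickson_poly a p) p = 1"
    using dickson_poly_monic[of p a] p3 by auto
  hence deg_G: "Suc (degree G) = p"
    using p3 by (auto simp: E degree_pCons_eq_if split: if_splits)
  \<comment> \<open>The constant coefficient of \<open>G\<close> is the linear coefficient of
    \<open>dickson_poly a p\<close>, hence its derivative at 0.\<close>
  have "coeff G 0 = coeff (pderiv (dickson_poly a p)) 0"
    by (simp add: coeff_G coeff_pderiv)
  also have "\<dots> = int p * (- a) ^ (p div 2)"
    using p by (simp add: pderiv_dickson_poly of_nat_poly coeff_0_dickson_poly2_odd)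
  finally have G0: "coeff G 0 = int p * (- a) ^ (p div 2)" .
  have "irreducible\<^sub>d G"
  proof (rule eisenstein_criterion)
    show "prime_elem (int p)"
      using p by simp
    show "\<not> int p dvd lead_coeff G"
      using monic(2) deg_G p3 by (simp add: coeff_G)
    show "int p dvd coeff G i" if "i < degree G" for i
      using that deg_G p by (simp add: coeff_G prime_dvd_coeff_dickson_poly)
    show "degree G > 0"
      using deg_G p3 by simp
    \<comment> \<open>So \<open>p\<close> divides \<open>coeff G 0\<close> exactly once.\<close>
    have "\<not> int p dvd (- a) ^ (p div 2)"
      using p a prime_dvd_power[of "int p" "- a"] by auto
    thus "\<not> (int p)\<^sup>2 dvd coeff G 0"
      using p3 by (simp add: G0 power2_eq_square)
  qed
  with E show ?thesis
    by (intro that[of G]) simp_all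
qed

lemma irreducible_quotient_dickson:
  fixes f :: "nat \<Rightarrow> rat poly"
  assumes p: "prime p" "odd p" and a: "\<not> int p dvd a" and c: "c \<noteq> 0" and d: "d \<noteq> 0"
    and f: "\<And>n. f n = smult c (of_int_poly (dickson_poly a n) \<circ>\<^sub>p [:b, d:])"
  shows "irreducible_quotient (f p) (f 1)"
proof -
  from p a obtain G where G: "dickson_poly a p = [:0, 1:] * G" "irreducible\<^sub>d G"
    by (rule dickson_poly_prime_factor)
  \<comment> \<open>Since \<open>f 1\<close> is \<open>c * (b + d * x)\<close>, it absorbs the
    scalar \<open>c\<close>, and \<open>H\<close> is exactly the quotient.\<close>
  define H :: "rat poly" where "H = of_int_poly G \<circ>\<^sub>p [:b, d:]"
  have f1: "f 1 = smult c [:b, d:]"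
    unfolding f by (simp add: pcompose_pCons)
  have "of_int_poly (dickson_poly a p) = [:0, 1:] * (of_int_poly G :: rat poly)"
    by (simp add: G(1) of_int_hom.map_poly_pCons_hom)
  hence fp: "f p = f 1 * H"
    unfolding f1 unfolding f H_def by (simp only: pcompose_mult) (simp add: pcompose_pCons smult_add_right)
  have "f 1 \<noteq> 0"
    using c d unfolding f1 by simp
  moreover have "irreducible H"
    \<comment> \<open>Gauss's lemma passes from the integers to the rationals.\<close>
    unfolding H_def using irreducible\<^sub>d_int_rat[OF G(2)] d
    by (intro irreducible_pcompose_linear) simp_all
  ultimately show ?thesis
    by (simp add: irreducible_quotient_def fp)
qed

section \<open>The six sequences as Dickson polynomials\<close>

lemma of_int_poly_dickson_poly:
  "of_int_poly (dickson_poly a n) = dickson_poly (of_int a :: rat) n"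
  by (induction a n rule: dickson_poly.induct) (simp_all add: of_int_hom.map_poly_pCons_hom of_int_poly_hom.hom_minus of_int_hom.map_poly_hom_smult)

text \<open>This replaces the defining recursion in the inductions below, so that compositions stay
  folded and match the induction hypotheses.\<close>

lemma dickson_poly_pcompose_Suc_Suc:
  "dickson_poly a (Suc (Suc n)) \<circ>\<^sub>p g
    = g * (dickson_poly a (Suc n) \<circ>\<^sub>p g) - [:a:] * (dickson_poly a n \<circ>\<^sub>p g)"
  by (simp only: dickson_poly.simps pcompose_diff pcompose_mult) (simp add: pcompose_pCons)

lemma lucas_poly_dickson: "lucas_poly n = dickson_poly (- 1) n \<circ>\<^sub>p [:0, 1:]"
  by (induction n rule: lucas_poly.induct)
    (simp_all add: dickson_poly_pcompose_Suc_Suc pcompose_pCons del: dickson_poly.simps(3))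

lemma pell_lucas_poly_dickson: "pell_lucas_poly n = dickson_poly (- 1) n \<circ>\<^sub>p [:0, 2:]"
  by (induction n rule: pell_lucas_poly.induct)
    (simp_all add: dickson_poly_pcompose_Suc_Suc pcompose_pCons del: dickson_poly.simps(3))

lemma fermat_lucas_poly_dickson: "fermat_lucas_poly n = dickson_poly 2 n \<circ>\<^sub>p [:0, 3:]"
  by (induction n rule: fermat_lucas_poly.induct)
    (simp_all add: dickson_poly_pcompose_Suc_Suc pcompose_pCons del: dickson_poly.simps(3))

text \<open>The factor \<open>1 / 2\<close> accounts for the initial value 1 instead of 2.\<close>

lemma chebyshev_T_poly_dickson:
  "chebyshev_T_poly n = smult (1 / 2) (dickson_poly 1 n \<circ>\<^sub>p [:0, 2:])"
  by (induction n rule: chebyshev_T_poly.induct)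
    (simp_all add: dickson_poly_pcompose_Suc_Suc pcompose_pCons smult_diff_right
      del: dickson_poly.simps(3))

lemma morgan_voyce_lucas_poly_dickson:
  "morgan_voyce_lucas_poly n = dickson_poly 1 n \<circ>\<^sub>p [:2, 1:]"
  by (induction n rule: morgan_voyce_lucas_poly.induct)
    (simp_all add: dickson_poly_pcompose_Suc_Suc pcompose_pCons del: dickson_poly.simps(3))

lemma vieta_lucas_poly_dickson: "vieta_lucas_poly n = dickson_poly 1 n \<circ>\<^sub>p [:0, 1:]"
  by (induction n rule: vieta_lucas_poly.induct)
    (simp_all add: dickson_poly_pcompose_Suc_Suc pcompose_pCons del: dickson_poly.simps(3))

theorem mainTheorem10:
  fixes p :: nat
  assumes "prime p" and "p > 2"
  shows "irreducible_quotient (lucas_poly p) (lucas_poly 1)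
    \<and> irreducible_quotient (pell_lucas_poly p) (pell_lucas_poly 1)
    \<and> irreducible_quotient (fermat_lucas_poly p) (fermat_lucas_poly 1)
    \<and> irreducible_quotient (chebyshev_T_poly p) (chebyshev_T_poly 1)
    \<and> irreducible_quotient (morgan_voyce_lucas_poly p) (morgan_voyce_lucas_poly 1)
    \<and> irreducible_quotient (vieta_lucas_poly p) (vieta_lucas_poly 1)"
proof -
  have odd: "odd p"
    using assms prime_odd_nat by blast
  \<comment> \<open>These are the three recurrence parameters; 2 belongs to Fermat-Lucas and is
    where oddness of \<open>p\<close> matters.\<close>
  have a: "\<not> int p dvd - 1" "\<not> int p dvd 1" "\<not> int p dvd 2"
    using assms(2) by (auto dest: zdvd_imp_le)
  note irr = irreducible_quotient_dickson[OF assms(1) odd, unfolded of_int_poly_dickson_poly]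
  show ?thesis
  proof (intro conjI)
    show "irreducible_quotient (lucas_poly p) (lucas_poly 1)"
      \<comment> \<open>Here and below the explicit arguments are the scalar \<open>c\<close>, the
        slope \<open>d\<close> and, after the sequence, the intercept \<open>b\<close>.\<close>
      by (rule irr[OF a(1), of 1 1 _ 0]) (simp_all add: lucas_poly_dickson)
    show "irreducible_quotient (pell_lucas_poly p) (pell_lucas_poly 1)"
      by (rule irr[OF a(1), of 1 2 _ 0]) (simp_all add: pell_lucas_poly_dickson)
    show "irreducible_quotient (fermat_lucas_poly p) (fermat_lucas_poly 1)"
      by (rule irr[OF a(3), of 1 3 _ 0]) (simp_all add: fermat_lucas_poly_dickson)
    show "irreducible_quotient (chebyshev_T_poly p) (chebyshev_T_poly 1)"
      by (rule irr[OF a(2), of "1 / 2" 2 _ 0]) (simp_all add: chebyshev_T_poly_dickson)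
    show "irreducible_quotient (morgan_voyce_lucas_poly p) (morgan_voyce_lucas_poly 1)"
      by (rule irr[OF a(2), of 1 1 _ 2]) (simp_all add: morgan_voyce_lucas_poly_dickson)
    show "irreducible_quotient (vieta_lucas_poly p) (vieta_lucas_poly 1)"
      by (rule irr[OF a(2), of 1 1 _ 0]) (simp_all add: vieta_lucas_poly_dickson)
  qed
qed

end
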